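(* Let $n\ge3$ and let $r,\tilde r,q,\tilde q\in[1,\infty]$ (with the convention $1/\infty=0$). Suppose that the estimate $$\|u\|_{L^r(\mathbb R^n;L^q([2,3]))}\le C\,\|F\|_{L^{\tilde r'}(\mathbb R^n;L^{\tilde q'}([0,1]))}$$ holds with a constant $C>0$ independent of $F$, where $u$ is the solution of the inhomogeneous Schrödinger equation $\mathrm i\partial_tu-\Delta u=F(t,x)$, $(t,x)\in\mathbb R\times\mathbb R^n$, with zero initial data $u(0,x)=0$ and with $F$ supported in the region $0\le t\le1$. Then necessarily $$\frac1r-\frac1{\tilde r}\le\frac1n ,$$ and, by duality (the dual of the operator $F\mapsto u$ is an operator with the same structure), also $$\frac1{\tilde r}-\frac1r\le\frac1n .$$ In this sense the range $0\le\frac1r\le\frac12$, $0\le\frac1{\tilde r}\le\frac12$, $\left|\frac1r-\frac1{\tilde r}\right|<\frac1n$, for which the estimate is known to hold for some $q,\tilde q\in[1,\infty]$, is almost optimal.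
   Context: The forcing term $F$ is supported in $0\le t\le1$ and the solution $u$ is looked at in the region $2\le t\le3$, where the operator $F\mapsto u$ is given (up to a constant factor of modulus one, irrelevant for the estimate) by $$u(t,x)=(4\pi)^{-n/2}\int_0^1\int_{\mathbb R^n}\frac{e^{-\mathrm i|x-y|^2/(4(t-s))}}{(t-s)^{n/2}}\,F(s,y)\,dy\,ds .$$ Primes denote conjugate exponents, $\frac1p+\frac1{p'}=1$. The mixed norm is $\|G\|_{L^r(\mathbb R^n;L^q(I))}=\big\|\,x\mapsto\|G(\cdot,x)\|_{L^q(I)}\,\big\|_{L^r(\mathbb R^n)}$, i.e. the norm in time is computed first and then the norm in space. *)

theory Defs
  imports "HOL-Probability.Essential_Supremum"
begin

(* x^a for x in [0,\<infinity>]; only used with a > 0, where \<infinity>^a = \<infinity>. *)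
definition ennpowr :: "ennreal \<Rightarrow> real \<Rightarrow> ennreal" where
  "ennpowr x a = (if x = \<infinity> then \<infinity> else ennreal (enn2real x powr a))"

(* The L^p norm, 1 \<le> p \<le> \<infinity>, of a [0,\<infinity>]-valued function; it may itself be infinite. *)
definition Lp_norm :: "ereal \<Rightarrow> 'a measure \<Rightarrow> ('a \<Rightarrow> ennreal) \<Rightarrow> ennreal" where
  "Lp_norm p M f =
     (if p = \<infinity> then esssup M f
      else ennpowr (\<integral>\<^sup>+ x. ennpowr (f x) (real_of_ereal p) \<partial>M) (1 / real_of_ereal p))"

(* Space-time functions take the time first. mixed_norm r q J G is the norm of G in
   L^r(R^n; L^q(J)). *)
definition mixed_norm ::
  "ereal \<Rightarrow> ereal \<Rightarrow> real set \<Rightarrow> (real \<Rightarrow> real ^ 'n \<Rightarrow> complex) \<Rightarrow> ennreal" where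
  "mixed_norm r q J G =
     Lp_norm r lborel (\<lambda>x. Lp_norm q (restrict_space lborel J) (\<lambda>t. ennreal (norm (G t x))))"

(* The lower bounds exclude -\<infinity>, whose reciprocal in ereal is also 0. *)
definition conjugate_exponents :: "ereal \<Rightarrow> ereal \<Rightarrow> bool" where
  "conjugate_exponents p p' \<longleftrightarrow> 1 \<le> p \<and> 1 \<le> p' \<and> 1 / p + 1 / p' = 1"

(* Forcing terms supported in 0 \<le> t \<le> 1: bounded Borel functions with bounded support. For these
   the integral defining the solution converges absolutely for t > 1, and all mixed norms are
   finite. An estimate for a larger class of F implies the one for this class. *)
definition forcing_term :: "(real \<Rightarrow> real ^ 'n \<Rightarrow> complex) \<Rightarrow> bool" where
  "forcing_term F \<longleftrightarrow>
     case_prod F \<in> borel_measurable borel \<and>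
     bounded (range (case_prod F)) \<and>
     bounded {(s, y). F s y \<noteq> 0} \<and>
     {(s, y). F s y \<noteq> 0} \<subseteq> {0..1} \<times> UNIV"

(* For t > 1 and F supported in 0 \<le> t \<le> 1: the Duhamel formula for the solution of
   i u_t - \<Delta>u = F, u(0) = 0, up to a constant factor of modulus one, which does not affect
   its norms. *)
definition schrodinger_solution ::
  "(real \<Rightarrow> real ^ 'n \<Rightarrow> complex) \<Rightarrow> real \<Rightarrow> real ^ 'n \<Rightarrow> complex" where
  "schrodinger_solution F t x =
     of_real ((4 * pi) powr (- real CARD('n) / 2)) *
     (LINT s:{0..1}|lborel. LINT y|lborel.
        exp (- (\<i> * of_real ((norm (x - y))\<^sup>2 / (4 * (t - s))))) /
        of_real ((t - s) powr (real CARD('n) / 2)) * F s y)"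

end

theory Submission
  imports Defs "HOL-Real_Asymp.Real_Asymp"
begin

text \<open>
  Let \<open>N\<close> be large. The forcing term \<open>exp (i (N\<^sup>2 s + N |y|))\<close> resonates at \<open>(t, x)\<close> with those
  \<open>(s, y)\<close> for which \<open>|x| + |y|\<close> is within distance 1 of \<open>2N (t - s)\<close>, provided that \<open>|x| |y|\<close> is
  small. The contribution of the other \<open>(s, y)\<close> is not estimated by stationary phase but removed by
  averaging: the forcing term is modulated by characters of the integer \<open>\<lfloor>|y| + 2Ns\<rfloor>\<close>, and a mean
  over roots of unity isolates the level set \<open>\<lfloor>|y| + 2Ns\<rfloor> = \<lfloor>2Nt - |x|\<rfloor>\<close>, on which all phases agree
  up to 1. So, on average over the characters, \<open>|u(t, x)| \<ge> c |B| / N\<close> for \<open>x \<in> A\<close> if the forcing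
  terms live on \<open>y \<in> B\<close>. By the Hoelder inequality the estimate then gives
  \<open>|A|\<^sup>a |B|\<^sup>b \<le> C' N\<close> with \<open>a = 1/r\<close> and \<open>b = 1/rt\<close>. Here one of \<open>A\<close>, \<open>B\<close> is a ball of radius of
  order \<open>N\<close> centred at distance \<open>4N\<close> from the origin and the other is a ball of radius of order
  \<open>1/N\<close> around the origin; the two choices give the two inequalities as \<open>N \<rightarrow> \<infinity>\<close>.
\<close>

section \<open>Hoelder bounds for \<open>Lp_norm\<close> and \<open>mixed_norm\<close>, and the
  norms of indicators\<close>

lemma ennpowr_measurable [measurable]:
  assumes [measurable]: "f \<in> borel_measurable M"
  shows "(\<lambda>x. ennpowr (f x) a) \<in> borel_measurable M"
  unfolding ennpowr_def by measurable

lemma ennpowr_mono: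
  assumes "x \<le> y" "0 \<le> a"
  shows "ennpowr x a \<le> ennpowr y a"
proof (cases "y = \<infinity>")
  case False
  then have "x \<noteq> \<infinity>" using assms by (auto simp: top_unique)
  moreover have "enn2real x \<le> enn2real y"
    using assms False by (simp add: enn2real_mono less_top)
  ultimately show ?thesis
    using False assms unfolding ennpowr_def by (auto intro!: ennreal_leI powr_mono2)
qed (simp add: ennpowr_def)

text \<open>The larger function may be non-measurable, so that a measurable function of
  \<open>x\<close> can be compared with the inner norm of a mixed norm without proving the latter
  measurable.\<close>

lemma Lp_norm_mono:
  assumes f: "f \<in> borel_measurable M" and le: "\<And>x. x \<in> space M \<Longrightarrow> f x \<le> g x" and p: "1 \<le> p"
  shows "Lp_norm p M f \<le> Lp_norm p M g"
proof (cases "p = \<infinity>")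
  case True
  then show ?thesis
    unfolding Lp_norm_def using f le by (auto intro!: esssup_AE_mono)
next
  case False
  with p have "0 \<le> real_of_ereal p" by (cases p) auto
  with False show ?thesis
    unfolding Lp_norm_def by (auto intro!: ennpowr_mono nn_integral_mono le)
qed

lemma real_of_inverse_exponent:
  assumes "(1::ereal) \<le> p" "p \<noteq> \<infinity>"
  obtains P where "p = ereal P" "1 \<le> P" "real_of_ereal (1 / p) = 1 / P"
  using assms by (cases p) (auto simp: one_ereal_def)

text \<open>A substitute for Young's inequality: up to the threshold \<alpha> the first term
  suffices, and above it \<open>y\<close> is the product of \<open>y^(1-P)\<close>, which is at most
  \<open>\<alpha>^(1-P)\<close>, and \<open>y^P\<close>. No conjugate exponent enters, so
  \<open>P = 1\<close> is no special case.\<close>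

lemma le_add_ennpowr:
  fixes P \<alpha> :: real
  assumes "1 \<le> P" "0 < \<alpha>"
  shows "y \<le> ennreal \<alpha> + ennreal (\<alpha> powr (1 - P)) * ennpowr y P"
proof (cases y)
  case top
  then show ?thesis using assms by (simp add: ennpowr_def ennreal_mult_top)
next
  case (real x)
  have "x \<le> \<alpha> + \<alpha> powr (1 - P) * x powr P"
  proof (cases "x \<le> \<alpha>")
    case False
    then have "x powr (1 - P) \<le> \<alpha> powr (1 - P)"
      using assms by (intro powr_mono2') auto
    then have "x powr (1 - P) * x powr P \<le> \<alpha> powr (1 - P) * x powr P"
      by (rule mult_right_mono) simp
    moreover have "x powr (1 - P) * x powr P = x"
      using False assms by (simp flip: powr_add)
    ultimately show ?thesis using assms by simp
  qed (use assms in \<open>auto intro: add_increasing2\<close>)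
  then show ?thesis
    using real assms
    by (simp add: ennpowr_def flip: ennreal_mult ennreal_plus)
qed

text \<open>Hoelder's inequality against an indicator, with a harmless loss of 2. For finite
  \<open>p\<close> it follows by integrating \<open>le_add_ennpowr\<close> and then choosing the
  threshold.\<close>

lemma nn_integral_le_Lp_norm:
  assumes f [measurable]: "f \<in> borel_measurable M" and A [measurable]: "A \<in> sets M"
    and m: "emeasure M A = ennreal m" "0 < m" and p: "1 \<le> p"
  shows "(\<integral>\<^sup>+x\<in>A. f x \<partial>M) \<le> 2 * ennreal (m powr (1 - real_of_ereal (1 / p))) * Lp_norm p M f"
proof (cases "p = \<infinity>")
  case True
  have "(\<integral>\<^sup>+x\<in>A. f x \<partial>M) \<le> (\<integral>\<^sup>+x. esssup M f * indicator A x \<partial>M)"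
    using esssup_AE[of f M] by (intro nn_integral_mono_AE) (auto elim!: eventually_mono split: split_indicator)
  also have "\<dots> = 1 * ennreal m * esssup M f"
    using m by (simp add: nn_integral_cmult mult.commute)
  also have "\<dots> \<le> 2 * ennreal m * esssup M f"
    by (intro mult_right_mono) auto
  finally show ?thesis using True m by (simp add: Lp_norm_def)
next
  case False
  then obtain P where P: "p = ereal P" "1 \<le> P" "real_of_ereal (1 / p) = 1 / P"
    using real_of_inverse_exponent[OF p] by metis
  define I where "I = (\<integral>\<^sup>+ x. ennpowr (f x) P \<partial>M)"
  have norm: "Lp_norm p M f = ennpowr I (1 / P)"
    using P by (simp add: Lp_norm_def I_def)
  have bound: "(\<integral>\<^sup>+x\<in>A. f x \<partial>M) \<le> ennreal (\<alpha> * m) + ennreal (\<alpha> powr (1 - P)) * I" if "0 < \<alpha>" for \<alpha>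
  proof -
    have "(\<integral>\<^sup>+x\<in>A. f x \<partial>M) \<le>
        (\<integral>\<^sup>+x. ennreal \<alpha> * indicator A x + ennreal (\<alpha> powr (1 - P)) * ennpowr (f x) P \<partial>M)"
      using le_add_ennpowr[OF P(2) that]
      by (intro nn_integral_mono) (auto split: split_indicator)
    also have "\<dots> = ennreal (\<alpha> * m) + ennreal (\<alpha> powr (1 - P)) * I"
      using that m by (simp add: nn_integral_add nn_integral_cmult I_def ennreal_mult)
    finally show ?thesis .
  qed
  show ?thesis
  proof (cases I)
    case top
    then show ?thesis using m norm by (simp add: ennpowr_def ennreal_mult_top ennreal_mult_eq_top_iff)
  next
    case (real i)
    show ?thesis
    proof (cases "i = 0")
      case True
      \<comment> \<open>If \<open>I\<close> vanishes, the threshold can tend to 0, which puts the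
        integral below every positive \<open>e\<close>.\<close>
      have "(\<integral>\<^sup>+x\<in>A. f x \<partial>M) \<le> 0 + ennreal e" if "0 < e" for e
        using bound[of "e / m"] that m True real by simp
      then have "(\<integral>\<^sup>+x\<in>A. f x \<partial>M) \<le> 0"
        by (rule ennreal_le_epsilon)
      then show ?thesis by simp
    next
      case False
      then have i: "0 < i" using real by simp
      \<comment> \<open>This threshold balances the two terms: both become
        \<open>m^(1-1/P) i^(1/P)\<close>, hence the factor 2.\<close>
      define \<alpha> where "\<alpha> = (i / m) powr (1 / P)"
      have "\<alpha> > 0" using i m by (simp add: \<alpha>_def)
      have 1: "\<alpha> * m = m powr (1 - 1 / P) * i powr (1 / P)"
        using i m by (simp add: \<alpha>_def powr_divide powr_diff)
      have "\<alpha> powr (1 - P) = (i / m) powr (1 / P - 1)"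
        using P by (simp add: \<alpha>_def powr_powr field_simps)
      then have 2: "\<alpha> powr (1 - P) * i = m powr (1 - 1 / P) * i powr (1 / P)"
        using i m by (simp add: powr_divide powr_diff)
      have "(\<integral>\<^sup>+x\<in>A. f x \<partial>M) \<le> ennreal (2 * (m powr (1 - 1 / P) * i powr (1 / P)))"
        using bound[OF \<open>\<alpha> > 0\<close>] 1 2 real i m \<open>\<alpha> > 0\<close>
        by (simp add: mult.commute flip: ennreal_mult ennreal_plus)
      then show ?thesis
        using norm real P i m
        by (simp add: ennpowr_def ennreal_mult mult.assoc)
    qed
  qed
qed

lemma Lp_norm_indicator:
  assumes [measurable]: "A \<in> sets M" and m: "emeasure M A = ennreal m" "0 < m" and p: "1 \<le> p"
  shows "Lp_norm p M (indicator A) = ennreal (m powr real_of_ereal (1 / p))"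
proof (cases "p = \<infinity>")
  case True
  have "esssup M (indicator A :: _ \<Rightarrow> ennreal) = 1"
  proof (rule antisym)
    show "esssup M (indicator A :: _ \<Rightarrow> ennreal) \<le> 1"
      by (intro esssup_I) (auto split: split_indicator)
    show "1 \<le> esssup M (indicator A :: _ \<Rightarrow> ennreal)"
    proof (rule ccontr)
      assume *: "\<not> 1 \<le> esssup M (indicator A :: _ \<Rightarrow> ennreal)"
      have "AE x in M. x \<notin> A"
        using esssup_AE[of "indicator A :: _ \<Rightarrow> ennreal" M]
        by (rule eventually_mono) (use * in \<open>auto split: split_indicator_asm\<close>)
      then have "emeasure M A = 0"
        by (subst (asm) AE_iff_measurable[of A]) (use sets.sets_into_space[OF assms(1)] in auto)
      then show False using m by simp
    qed
  qed
  then show ?thesis using True m by (simp add: Lp_norm_def)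
next
  case False
  then obtain P where P: "p = ereal P" "1 \<le> P" "real_of_ereal (1 / p) = 1 / P"
    using real_of_inverse_exponent[OF p] by metis
  have "ennpowr (indicator A x) P = indicator A x" for x
    by (auto simp: ennpowr_def split: split_indicator)
  then have "Lp_norm p M (indicator A) = ennpowr (emeasure M A) (1 / P)"
    using P by (simp add: Lp_norm_def)
  then show ?thesis using P m by (simp add: ennpowr_def)
qed

text \<open>Hoelder in time and then in space, each at the cost of a factor 2. Since
  \<open>J\<close> has length 1, the time exponent \<open>q\<close> leaves no trace.\<close>

lemma L1_le_mixed_norm:
  fixes G :: "real \<Rightarrow> real ^ 'n::finite \<Rightarrow> complex"
  assumes G [measurable]: "case_prod G \<in> borel_measurable borel"
    and J [measurable]: "J \<in> sets borel" "emeasure lborel J = 1"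
    and A [measurable]: "A \<in> sets borel" "emeasure lborel A = ennreal m" "0 < m"
    and r: "1 \<le> r" and q: "1 \<le> q"
  shows "(\<integral>\<^sup>+x\<in>A. (\<integral>\<^sup>+t\<in>J. ennreal (norm (G t x)) \<partial>lborel) \<partial>lborel)
    \<le> 4 * ennreal (m powr (1 - real_of_ereal (1 / r))) * mixed_norm r q J G"
proof -
  have G' [measurable]: "case_prod G \<in> borel_measurable (borel \<Otimes>\<^sub>M borel)"
    using G by (simp add: borel_prod)
  define f where "f x = (\<integral>\<^sup>+t\<in>J. ennreal (norm (G t x)) \<partial>lborel)" for x
  have f [measurable]: "f \<in> borel_measurable lborel"
    unfolding f_def by measurable
  \<comment> \<open>Halving compensates the factor lost in time, so \<open>h\<close> lies below the
    inner norm; being measurable, it can take the place of that norm in the space integral.\<close>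
  define h where "h x = f x / 2" for x
  have h [measurable]: "h \<in> borel_measurable lborel"
    unfolding h_def by measurable
  have two: "2 * (y / 2) = y" for y :: ennreal
    by (simp add: ennreal_times_divide mult.commute ennreal_mult_divide_eq)
  have fh: "f x = 2 * h x" for x
    by (simp add: h_def two)
  have h_le: "h x \<le> Lp_norm q (restrict_space lborel J) (\<lambda>t. ennreal (norm (G t x)))" for x
  proof -
    have "f x = (\<integral>\<^sup>+t\<in>J. ennreal (norm (G t x)) \<partial>restrict_space lborel J)"
      unfolding f_def by (subst nn_integral_restrict_space) (auto intro!: nn_integral_cong split: split_indicator)
    also have "\<dots> \<le> 2 * ennreal (1 powr (1 - real_of_ereal (1 / q)))
        * Lp_norm q (restrict_space lborel J) (\<lambda>t. ennreal (norm (G t x)))"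
      by (rule nn_integral_le_Lp_norm)
        (use J q in \<open>auto simp: emeasure_restrict_space sets_restrict_space intro!: measurable_restrict_space1\<close>)
    finally have "2 * h x \<le> 2 * Lp_norm q (restrict_space lborel J) (\<lambda>t. ennreal (norm (G t x)))"
      by (simp add: fh)
    then show ?thesis by (simp add: ennreal_mult_le_mult_iff)
  qed
  have "(\<integral>\<^sup>+x\<in>A. f x \<partial>lborel) = 2 * (\<integral>\<^sup>+x\<in>A. h x \<partial>lborel)"
    by (simp add: fh mult.assoc nn_integral_cmult)
  also have "\<dots> \<le> 2 * (2 * ennreal (m powr (1 - real_of_ereal (1 / r))) * Lp_norm r lborel h)"
    using A r by (intro mult_left_mono nn_integral_le_Lp_norm) auto
  also have "\<dots> \<le> 2 * (2 * ennreal (m powr (1 - real_of_ereal (1 / r))) * mixed_norm r q J G)"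
    unfolding mixed_norm_def by (intro mult_left_mono Lp_norm_mono h_le h r) auto
  finally show ?thesis
    unfolding f_def by (simp flip: mult.assoc)
qed

text \<open>On a time set of measure 1 the norm of a constant is its modulus for every
  \<open>q\<close>, so only the space exponent is felt.\<close>

lemma mixed_norm_indicator:
  fixes F :: "real \<Rightarrow> real ^ 'n::finite \<Rightarrow> complex"
  assumes J [measurable]: "J \<in> sets borel" "emeasure lborel J = 1"
    and B [measurable]: "B \<in> sets borel" "emeasure lborel B = ennreal m" "0 < m"
    and r: "1 \<le> r" and q: "1 \<le> q"
    and F: "\<And>t x. t \<in> J \<Longrightarrow> norm (F t x) = indicator B x"
  shows "mixed_norm r q J F = ennreal (m powr real_of_ereal (1 / r))"
proof -
  let ?M = "restrict_space lborel J"
  have "Lp_norm q ?M (\<lambda>t. ennreal (norm (F t x))) = indicator B x" for x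
  proof (cases "x \<in> B")
    case True
    have eq: "t \<in> space ?M \<Longrightarrow> ennreal (norm (F t x)) = indicator J t" for t
      by (auto simp: F True space_restrict_space)
    then have "(\<lambda>t. ennreal (norm (F t x))) \<in> borel_measurable ?M"
      by (subst measurable_cong[OF eq]) (auto intro!: measurable_restrict_space1)
    \<comment> \<open>Monotonicity in both directions acts as a congruence rule for functions known
      to agree on the space of the measure.\<close>
    then have "Lp_norm q ?M (\<lambda>t. ennreal (norm (F t x))) = Lp_norm q ?M (indicator J)"
      by (intro antisym Lp_norm_mono q) (auto simp: eq intro!: measurable_restrict_space1)
    also have "\<dots> = ennreal (1 powr real_of_ereal (1 / q))"
      using J q by (intro Lp_norm_indicator) (auto simp: emeasure_restrict_space sets_restrict_space)
    finally show ?thesis using True by simp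
  next
    case False
    have ms: "emeasure ?M (space ?M) \<noteq> 0"
      using J by (simp add: emeasure_restrict_space space_restrict_space)
    have eq: "t \<in> space ?M \<Longrightarrow> ennreal (norm (F t x)) = 0" for t
      by (auto simp: F False space_restrict_space)
    then have "(\<lambda>t. ennreal (norm (F t x))) \<in> borel_measurable ?M"
      by (subst measurable_cong[OF eq]) auto
    then have "Lp_norm q ?M (\<lambda>t. ennreal (norm (F t x))) = Lp_norm q ?M (\<lambda>_. 0)"
      by (intro antisym Lp_norm_mono q) (auto simp: eq)
    also have "\<dots> = 0"
      unfolding Lp_norm_def using esssup_const[OF ms, of "0::ennreal"]
      by (auto simp: ennpowr_def)
    finally show ?thesis using False by simp
  qed
  then show ?thesis
    unfolding mixed_norm_def using B r by (simp add: Lp_norm_indicator)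
qed

section \<open>The Duhamel integral: integrability, measurability, linearity\<close>

lemma norm_kernel_mult_le:
  assumes "1 \<le> \<tau>" "0 \<le> a"
  shows "norm (exp (- (\<i> * of_real z)) / of_real (\<tau> powr a) * w) \<le> norm (w :: complex)"
proof -
  have "1 \<le> \<tau> powr a"
    using powr_mono2[of a 1 \<tau>] assms by simp
  moreover have "norm (exp (- (\<i> * of_real z))) = 1"
    by (simp add: norm_exp_eq_Re)
  ultimately show ?thesis
    by (simp add: norm_mult norm_divide divide_le_eq mult_left_le_one_le mult_le_cancel_left1)
qed

lemma forcing_term_measurable:
  "forcing_term F \<Longrightarrow> case_prod F \<in> borel_measurable (borel \<Otimes>\<^sub>M borel)"
  by (simp add: forcing_term_def borel_prod)

lemma forcing_term_outside:
  "forcing_term F \<Longrightarrow> s \<notin> {0..1} \<Longrightarrow> F s y = 0"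
  unfolding forcing_term_def by blast

text \<open>The forcing term is bounded and its support has finite measure, while the kernel has
  modulus at most 1 because \<open>t - s\<close> is at least 1 on that support.\<close>

lemma schrodinger_kernel_integrable:
  fixes F :: "real \<Rightarrow> real ^ 'n::finite \<Rightarrow> complex"
  assumes F: "forcing_term F" and t: "2 \<le> t"
  shows "integrable (lborel \<Otimes>\<^sub>M lborel) (\<lambda>(s, y).
      exp (- (\<i> * of_real ((norm (x - y))\<^sup>2 / (4 * (t - s))))) /
        of_real ((t - s) powr (real CARD('n) / 2)) * F s y)" (is "integrable _ ?f")
proof -
  have [measurable]: "case_prod F \<in> borel_measurable (borel \<Otimes>\<^sub>M borel)"
    using F by (rule forcing_term_measurable)
  obtain b where b: "\<And>s y. norm (F s y) \<le> b"
    using F by (fastforce simp: forcing_term_def bounded_iff)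
  define S where "S = {p. case_prod F p \<noteq> 0}"
  have "S = {(s, y). F s y \<noteq> 0}"
    by (auto simp: S_def)
  then have "bounded S"
    using F by (simp add: forcing_term_def)
  have S [measurable]: "S \<in> sets (lborel \<Otimes>\<^sub>M lborel)"
    using measurable_sets[of "case_prod F" "lborel \<Otimes>\<^sub>M lborel" borel "- {0}"]
    by (simp add: S_def space_pair_measure vimage_def)
  show ?thesis
  proof (rule integrableI_bounded_set[OF S])
    show "?f \<in> borel_measurable (lborel \<Otimes>\<^sub>M lborel)"
      by measurable
    show "emeasure (lborel \<Otimes>\<^sub>M lborel) S < \<infinity>"
      using emeasure_bounded_finite[OF \<open>bounded S\<close>] by (simp add: lborel_prod)
    have "norm (?f p) \<le> b" for p
    proof (cases "fst p \<in> {0..1}")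
      case True
      then have "norm (?f p) \<le> norm (case_prod F p)"
        using t unfolding case_prod_beta by (intro norm_kernel_mult_le) auto
      also have "\<dots> \<le> b"
        using b by (simp add: case_prod_beta)
      finally show ?thesis .
    next
      case False
      then show ?thesis
        using forcing_term_outside[OF F False] order_trans[OF norm_ge_zero b]
        by (simp add: case_prod_beta)
    qed
    then show "AE p in lborel \<Otimes>\<^sub>M lborel. p \<in> S \<longrightarrow> norm (?f p) \<le> b"
      by simp
    show "AE p in lborel \<Otimes>\<^sub>M lborel. p \<notin> S \<longrightarrow> ?f p = 0"
      by (auto simp: S_def)
  qed
qed

lemma schrodinger_solution_eq_pair_integral:
  fixes F :: "real \<Rightarrow> real ^ 'n::finite \<Rightarrow> complex"
  assumes F: "forcing_term F" and t: "2 \<le> t"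
  shows "schrodinger_solution F t x = of_real ((4 * pi) powr (- real CARD('n) / 2)) *
    (LINT (s, y)|(lborel \<Otimes>\<^sub>M lborel).
      exp (- (\<i> * of_real ((norm (x - y))\<^sup>2 / (4 * (t - s))))) /
        of_real ((t - s) powr (real CARD('n) / 2)) * F s y)"
proof -
  let ?f = "\<lambda>s y. exp (- (\<i> * of_real ((norm (x - y))\<^sup>2 / (4 * (t - s))))) /
        of_real ((t - s) powr (real CARD('n) / 2)) * F s y"
  have "(LINT s:{0..1}|lborel. LINT y|lborel. ?f s y) = (LINT s|lborel. LINT y|lborel. ?f s y)"
    unfolding set_lebesgue_integral_def
    using forcing_term_outside[OF F] by (intro Bochner_Integration.integral_cong) (auto split: split_indicator)
  also have "\<dots> = (LINT (s, y)|(lborel \<Otimes>\<^sub>M lborel). ?f s y)"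
    by (rule lborel_pair.integral_fst'[OF schrodinger_kernel_integrable[OF F t], unfolded split])
  finally show ?thesis
    by (simp add: schrodinger_solution_def)
qed

lemma schrodinger_solution_measurable:
  fixes F :: "real \<Rightarrow> real ^ 'n::finite \<Rightarrow> complex"
  assumes F: "forcing_term F"
  shows "case_prod (schrodinger_solution F) \<in> borel_measurable borel"
proof -
  have [measurable]: "case_prod F \<in> borel_measurable (borel \<Otimes>\<^sub>M borel)"
    using F by (rule forcing_term_measurable)
  have "case_prod (schrodinger_solution F) \<in> borel_measurable (borel \<Otimes>\<^sub>M borel)"
    unfolding schrodinger_solution_def set_lebesgue_integral_def by measurable
  then show ?thesis by (simp add: borel_prod)
qed

text \<open>The sum stays inside the integral, where the averaging over characters acts pointwise in
  \<open>(s, y)\<close>.\<close>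

lemma schrodinger_solution_sum:
  fixes F :: "'i \<Rightarrow> real \<Rightarrow> real ^ 'n::finite \<Rightarrow> complex"
  assumes F: "\<And>j. j \<in> I \<Longrightarrow> forcing_term (F j)" and t: "2 \<le> t"
  shows "(\<Sum>j\<in>I. c j * schrodinger_solution (F j) t x) =
    of_real ((4 * pi) powr (- real CARD('n) / 2)) *
    (LINT (s, y)|(lborel \<Otimes>\<^sub>M lborel).
      exp (- (\<i> * of_real ((norm (x - y))\<^sup>2 / (4 * (t - s))))) /
        of_real ((t - s) powr (real CARD('n) / 2)) * (\<Sum>j\<in>I. c j * F j s y))"
proof -
  let ?K = "\<lambda>s y. exp (- (\<i> * of_real ((norm (x - y))\<^sup>2 / (4 * (t - s))))) /
        of_real ((t - s) powr (real CARD('n) / 2))"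
  have int: "integrable (lborel \<Otimes>\<^sub>M lborel) (\<lambda>(s, y). ?K s y * F j s y)" if "j \<in> I" for j
    using schrodinger_kernel_integrable[OF F[OF that] t] .
  have "(LINT (s, y)|(lborel \<Otimes>\<^sub>M lborel). ?K s y * (\<Sum>j\<in>I. c j * F j s y))
    = (LINT p|(lborel \<Otimes>\<^sub>M lborel). (\<Sum>j\<in>I. c j * (case p of (s, y) \<Rightarrow> ?K s y * F j s y)))"
    by (intro Bochner_Integration.integral_cong refl)
      (simp only: case_prod_beta sum_distrib_left mult.left_commute)
  also have "\<dots> = (\<Sum>j\<in>I. c j * (LINT (s, y)|(lborel \<Otimes>\<^sub>M lborel). ?K s y * F j s y))"
    by (simp only: Bochner_Integration.integral_sum[OF integrable_mult_right] int
        integral_mult_right_zero cong: sum.cong)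
  finally show ?thesis
    using F t by (simp add: schrodinger_solution_eq_pair_integral sum_distrib_left mult.left_commute)
qed

section \<open>Roots of unity, the resonant phase and the modulated waves\<close>

lemma sum_roots_of_unity:
  fixes k :: int and L :: nat
  assumes "\<bar>k\<bar> < int L"
  shows "(\<Sum>j<L. cis (2 * pi * real j * of_int k / real L)) = (if k = 0 then of_nat L else 0)"
proof (cases "k = 0")
  case False
  define z where "z = cis (2 * pi * of_int k / real L)"
  have L: "0 < L" using assms by linarith
  \<comment> \<open>A nonzero \<open>k\<close> with modulus below \<open>L\<close> is no multiple of
    \<open>L\<close>, so \<open>z\<close> is a nontrivial \<open>L\<close>-th root of unity and its
    geometric sum vanishes.\<close>
  have "z \<noteq> 1"
  proof
    assume "z = 1"
    then have "cos (2 * pi * of_int k / real L) = 1"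
      unfolding z_def by (metis cis.sel(1) one_complex.sel(1))
    then obtain i :: int where "2 * pi * of_int k / real L = of_int i * 2 * pi"
      using cos_one_2pi_int by auto
    then have "of_int k = (of_int (i * int L) :: real)"
      using L by (simp add: field_simps)
    then have "k = i * int L"
      by (simp only: of_int_eq_iff)
    with assms False show False
      by (auto simp: abs_mult)
  qed
  have "z ^ L = cis (real L * (2 * pi * of_int k / real L))"
    unfolding z_def by (rule Complex.DeMoivre)
  also have "\<dots> = cis (2 * pi * of_int k)"
    using L by simp
  also have "\<dots> = 1"
    by (simp add: cis_multiple_2pi)
  finally have "z ^ L = 1" .
  have "(\<Sum>j<L. cis (2 * pi * real j * of_int k / real L)) = (\<Sum>j<L. z ^ j)"
    by (intro sum.cong refl) (simp add: z_def Complex.DeMoivre mult_ac)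
  also have "\<dots> = 0"
    using \<open>z \<noteq> 1\<close> \<open>z ^ L = 1\<close> by (simp add: sum_gp_strict)
  finally show ?thesis using False by simp
qed simp

text \<open>With \<open>\<tau> = t - s\<close>, the phase is \<open>-(|x| + |y| - 2N\<tau>)\<^sup>2 / (4\<tau>)\<close> up to an error of at most
  \<open>|x| |y| / \<tau>\<close>.\<close>
lemma phase_bound:
  fixes x y :: "'a::real_inner" and N s t :: real
  assumes \<tau>: "1 \<le> t - s" and xy: "norm x * norm y \<le> 1 / 2"
    and eq: "\<lfloor>norm y + 2 * N * s\<rfloor> = \<lfloor>2 * N * t - norm x\<rfloor>"
  shows "\<bar>- ((norm (x - y))\<^sup>2 / (4 * (t - s))) + N\<^sup>2 * s + N * norm y + (N * norm x - N\<^sup>2 * t)\<bar> \<le> 1"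
proof -
  define \<tau> where "\<tau> = t - s"
  have "1 \<le> \<tau>" using assms by (simp add: \<tau>_def)
  define w where "w = norm x + norm y - 2 * N * \<tau>"
  \<comment> \<open>\<open>w\<close> is the difference of the two numbers whose floors
    agree.\<close>
  have "\<bar>w\<bar> < 1"
    using eq unfolding w_def \<tau>_def by (simp add: algebra_simps) linarith
  then have w: "w\<^sup>2 \<le> 1" by (simp add: abs_square_le_1)
  have ip: "\<bar>x \<bullet> y\<bar> \<le> 1 / 2"
    using Cauchy_Schwarz_ineq2[of x y] xy by linarith
  have nn: "0 \<le> norm x * norm y" by simp
  have "(norm (x - y))\<^sup>2 = (norm x)\<^sup>2 + (norm y)\<^sup>2 - 2 * (x \<bullet> y)"
    by (simp add: power2_norm_eq_inner inner_diff inner_commute algebra_simps)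
  \<comment> \<open>Completing the square: the terms in \<open>N\<close> turn
    \<open>(|x| + |y|)^2\<close> into \<open>w^2\<close>, and the rest is what separates
    \<open>|x - y|^2\<close> from \<open>(|x| + |y|)^2\<close>.\<close>
  then have "- (norm (x - y))\<^sup>2 + 4 * \<tau> * (N * (norm x + norm y) - N\<^sup>2 * \<tau>)
      = - w\<^sup>2 + 2 * (norm x * norm y) + 2 * (x \<bullet> y)"
    unfolding w_def by (simp add: power2_eq_square algebra_simps)
  moreover have "4 * \<tau> * (- ((norm (x - y))\<^sup>2 / (4 * \<tau>)) + N\<^sup>2 * s + N * norm y + (N * norm x - N\<^sup>2 * t))
      = - (norm (x - y))\<^sup>2 + 4 * \<tau> * (N * (norm x + norm y) - N\<^sup>2 * \<tau>)"
    using \<open>1 \<le> \<tau>\<close> by (simp add: field_simps \<tau>_def)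
  \<comment> \<open>Each of the three terms on the right has modulus at most 1. The cruder bound 4
    is all that is needed after division by \<open>4 * \<tau>\<close>.\<close>
  ultimately have "\<bar>4 * \<tau> * (- ((norm (x - y))\<^sup>2 / (4 * \<tau>)) + N\<^sup>2 * s + N * norm y + (N * norm x - N\<^sup>2 * t))\<bar> \<le> 4"
    using w ip nn xy zero_le_power2[of w] by linarith
  then have "\<bar>4 * \<tau>\<bar> * \<bar>- ((norm (x - y))\<^sup>2 / (4 * \<tau>)) + N\<^sup>2 * s + N * norm y + (N * norm x - N\<^sup>2 * t)\<bar> \<le> 4"
    (is "_ * ?Q \<le> _") unfolding abs_mult .
  then have le: "\<tau> * ?Q \<le> 1"
    using \<open>1 \<le> \<tau>\<close> by linarith
  have "?Q = 1 * ?Q" by simp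
  also have "\<dots> \<le> \<tau> * ?Q"
    using \<open>1 \<le> \<tau>\<close> by (intro mult_right_mono) auto
  also note le
  finally show ?thesis
    unfolding \<tau>_def .
qed

lemma Re_cis_ge_half:
  assumes "\<bar>a\<bar> \<le> 1"
  shows "1 / 2 \<le> Re (cis a)"
proof -
  have "\<bar>a\<bar> \<le> pi / 3" using assms pi_gt3 by linarith
  then have "cos (pi / 3) \<le> cos \<bar>a\<bar>"
    by (intro cos_monotone_0_pi_le) auto
  then show ?thesis by (simp add: cos_60)
qed

text \<open>The term with \<open>j\<close> is the \<open>j\<close>-th character of the integers
  modulo \<open>L\<close>, evaluated at the floor; \<open>j = 0\<close> gives the plain wave. All
  these waves have the same modulus and therefore the same mixed norms.\<close>

definition modulated_wave :: "real \<Rightarrow> (real ^ 'n) set \<Rightarrow> nat \<Rightarrow> nat \<Rightarrow> real \<Rightarrow> real ^ 'n \<Rightarrow> complex" where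
  "modulated_wave N B L j s y = (if s \<in> {0..1} \<and> y \<in> B
     then cis (N\<^sup>2 * s + N * norm y + 2 * pi * real j * of_int \<lfloor>norm y + 2 * N * s\<rfloor> / real L) else 0)"

lemma norm_modulated_wave:
  "s \<in> {0..1} \<Longrightarrow> norm (modulated_wave N B L j s y) = indicator B y"
  by (auto simp: modulated_wave_def)

lemma borel_measurable_cis [measurable (raw)]:
  "f \<in> borel_measurable M \<Longrightarrow> (\<lambda>x. cis (f x)) \<in> borel_measurable M"
  unfolding cis_conv_exp by measurable

lemma forcing_term_modulated_wave:
  fixes B :: "(real ^ 'n::finite) set"
  assumes B [measurable]: "B \<in> sets borel" and bdd: "bounded B"
  shows "forcing_term (modulated_wave N B L j)"
  unfolding forcing_term_def
proof (intro conjI)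
  have "case_prod (modulated_wave N B L j) \<in> borel_measurable (borel \<Otimes>\<^sub>M borel)"
    unfolding modulated_wave_def by measurable
  then show "case_prod (modulated_wave N B L j) \<in> borel_measurable borel"
    by (simp add: borel_prod)
  show "bounded (range (case_prod (modulated_wave N B L j)))"
    by (auto simp: bounded_iff modulated_wave_def intro!: exI[of _ 1])
  show "bounded {(s, y). modulated_wave N B L j s y \<noteq> 0}"
    by (rule bounded_subset[OF bounded_Times[OF bounded_closed_interval bdd, of 0 1]])
      (auto simp: modulated_wave_def)
  show "{(s, y). modulated_wave N B L j s y \<noteq> 0} \<subseteq> {0..1} \<times> UNIV"
    by (auto simp: modulated_wave_def)
qed

text \<open>Fourier inversion on the integers modulo \<open>L\<close>. The hypothesis excludes
  aliasing, that is, other floor values congruent to \<open>m\<close>.\<close>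

lemma sum_modulated_wave:
  assumes "s \<in> {0..1} \<Longrightarrow> y \<in> B \<Longrightarrow> \<bar>\<lfloor>norm y + 2 * N * s\<rfloor> - m\<bar> < int L"
  shows "(\<Sum>j<L. cis (- (2 * pi * real j * of_int m / real L)) * modulated_wave N B L j s y) =
    (if s \<in> {0..1} \<and> y \<in> B \<and> \<lfloor>norm y + 2 * N * s\<rfloor> = m
     then of_nat L * cis (N\<^sup>2 * s + N * norm y) else 0)"
proof (cases "s \<in> {0..1} \<and> y \<in> B")
  case True
  let ?k = "\<lfloor>norm y + 2 * N * s\<rfloor>"
  have "cis (- (2 * pi * real j * of_int m / real L)) * modulated_wave N B L j s y =
      cis (2 * pi * real j * of_int (?k - m) / real L) * cis (N\<^sup>2 * s + N * norm y)" for j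
    using True by (simp add: modulated_wave_def cis_mult algebra_simps diff_divide_distrib)
  then show ?thesis
    using assms True sum_roots_of_unity[of "?k - m" L]
    by (simp flip: sum_distrib_right)
qed (auto simp: modulated_wave_def)

section \<open>Lower bound for the averaged solutions\<close>

lemma emeasure_resonant_set:
  fixes B :: "(real ^ 'n::finite) set"
  assumes B [measurable]: "B \<in> sets borel" and N: "0 < N"
    and inside: "\<And>y. y \<in> B \<Longrightarrow> norm y \<le> of_int m \<and> of_int m + 1 - norm y \<le> 2 * N"
  shows "emeasure (lborel \<Otimes>\<^sub>M lborel)
    {(s, y). s \<in> {0..1} \<and> y \<in> B \<and> \<lfloor>norm y + 2 * N * s\<rfloor> = m} = ennreal (1 / (2 * N)) * emeasure lborel B"
    (is "emeasure _ ?E = _")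
proof -
  have "{p \<in> space (borel \<Otimes>\<^sub>M borel). fst p \<in> {0..1} \<and> snd p \<in> B \<and> \<lfloor>norm (snd p) + 2 * N * fst p\<rfloor> = m}
      \<in> sets (borel \<Otimes>\<^sub>M borel)"
    by measurable
  then have E: "?E \<in> sets (lborel \<Otimes>\<^sub>M lborel)"
    by (simp add: space_pair_measure case_prod_beta')
  \<comment> \<open>For fixed \<open>y\<close> the floor condition describes a half-open interval of
    length \<open>1 / (2 * N)\<close> in \<open>s\<close>; the hypothesis \<open>inside\<close>
    places it entirely within \<open>{0..1}\<close>.\<close>
  have slice: "emeasure lborel ((\<lambda>s. (s, y)) -` ?E) = ennreal (1 / (2 * N)) * indicator B y" for y
  proof (cases "y \<in> B")
    case True
    have "(\<lambda>s. (s, y)) -` ?E = {(of_int m - norm y) / (2 * N)..<(of_int m + 1 - norm y) / (2 * N)}"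
    proof (intro set_eqI)
      fix s
      have "(\<lfloor>norm y + 2 * N * s\<rfloor> = m) \<longleftrightarrow>
          s \<in> {(of_int m - norm y) / (2 * N)..<(of_int m + 1 - norm y) / (2 * N)}"
        using N by (simp add: floor_eq_iff field_simps)
      moreover have "0 \<le> (of_int m - norm y) / (2 * N)" "(of_int m + 1 - norm y) / (2 * N) \<le> 1"
        using inside[OF True] N by (auto simp: field_simps)
      ultimately show "s \<in> (\<lambda>s. (s, y)) -` ?E \<longleftrightarrow>
          s \<in> {(of_int m - norm y) / (2 * N)..<(of_int m + 1 - norm y) / (2 * N)}"
        using True by auto
    qed
    then show ?thesis
      using N True by (simp add: divide_right_mono flip: diff_divide_distrib)
  qed simp
  show ?thesis
    using E by (subst lborel_pair.emeasure_pair_measure_alt2) (simp_all only: slice, simp add: nn_integral_cmult)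
qed

text \<open>Weighting the \<open>j\<close>-th solution with the conjugate character at
  \<open>m\<close> reduces the sum to \<open>L\<close> times an integral over the resonant set,
  where no cancellation occurs. The constant collects the Duhamel factor, the decay for
  \<open>t - s\<close> at most 3, the cosine bound 1/2, and the measure \<open>|B| / (2 N)\<close>
  of that set.\<close>

lemma sum_norm_schrodinger_solution_ge:
  fixes B :: "(real ^ 'n::finite) set" and x :: "real ^ 'n"
  assumes B [measurable]: "B \<in> sets borel" and bdd: "bounded B"
    and N: "4 \<le> N" and t: "t \<in> {19/8..21/8}"
    and xB: "\<And>y. y \<in> B \<Longrightarrow> norm x * norm y \<le> 1 / 2 \<and> norm x + norm y \<in> {7/2 * N..9/2 * N}"
    and x: "norm x \<le> 9/2 * N" and L: "9 * N + 9 \<le> real L"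
  shows "real L * (((4 * pi) powr (- real CARD('n) / 2) * (3 powr (- real CARD('n) / 2) / 2)) * (measure lborel B / (2 * N)))
    \<le> (\<Sum>j<L. norm (schrodinger_solution (modulated_wave N B L j) t x))"
proof -
  define m where "m = \<lfloor>2 * N * t - norm x\<rfloor>"
  define c where "c = (4 * pi) powr (- real CARD('n) / 2)"
  define d where "d = (3::real) powr (- real CARD('n) / 2) / 2"
  define E where "E = {(s, y). s \<in> {0..1} \<and> y \<in> B \<and> \<lfloor>norm y + 2 * N * s\<rfloor> = m}"
  define K where "K s y = exp (- (\<i> * of_real ((norm (x - y))\<^sup>2 / (4 * (t - s))))) /
        of_real ((t - s) powr (real CARD('n) / 2))" for s y
  define f where "f = (\<lambda>(s, y). K s y * (\<Sum>j<L. cis (- (2 * pi * real j * of_int m / real L)) * modulated_wave N B L j s y))"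
  \<comment> \<open>Minus the phase common to all resonant \<open>(s, y)\<close>, up to an error of
    1; it depends on \<open>(t, x)\<close> alone.\<close>
  define a where "a = N * norm x - N\<^sup>2 * t"
  have Nt: "19/4 * N \<le> 2 * N * t" "2 * N * t \<le> 21/4 * N"
    using t N by (auto simp: field_simps)
  have m: "of_int m \<le> 2 * N * t - norm x" "2 * N * t - norm x < of_int m + 1"
    unfolding m_def by linarith+
  have f_eq: "f (s, y) = indicator E (s, y) * (of_nat L * (K s y * cis (N\<^sup>2 * s + N * norm y)))" for s y
  proof -
    \<comment> \<open>The two integers differ by at most \<open>21/4 * N + 1\<close>, so the assumed
      size of \<open>L\<close> leaves ample room.\<close>
    have "\<bar>\<lfloor>norm y + 2 * N * s\<rfloor> - m\<bar> < int L" if "s \<in> {0..1}" "y \<in> B"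
    proof -
      have "0 \<le> 2 * N * s" "2 * N * s \<le> 2 * N * 1"
        using that N by (auto intro!: mult_left_mono)
      moreover have "norm y \<le> 9/2 * N - norm x"
        using xB[OF that(2)] by auto
      ultimately have "\<bar>real_of_int (\<lfloor>norm y + 2 * N * s\<rfloor> - m)\<bar> < real L"
        using Nt m x L N norm_ge_zero[of x] norm_ge_zero[of y] by linarith
      then show ?thesis by linarith
    qed
    from sum_modulated_wave[OF this] show ?thesis
      unfolding f_def E_def by simp
  qed
  have t2: "2 \<le> t" using t by simp
  have wave: "forcing_term (modulated_wave N B L j)" for j
    using B bdd by (rule forcing_term_modulated_wave)
  have S: "(\<Sum>j<L. cis (- (2 * pi * real j * of_int m / real L)) * schrodinger_solution (modulated_wave N B L j) t x)
      = of_real c * (LINT p|(lborel \<Otimes>\<^sub>M lborel). f p)"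
    unfolding f_def K_def c_def by (rule schrodinger_solution_sum[OF wave t2])
  have int: "integrable (lborel \<Otimes>\<^sub>M lborel) f"
  proof -
    have "integrable (lborel \<Otimes>\<^sub>M lborel) (\<lambda>p. \<Sum>j<L. cis (- (2 * pi * real j * of_int m / real L)) *
        (case p of (s, y) \<Rightarrow> K s y * modulated_wave N B L j s y))"
      unfolding K_def
      by (intro Bochner_Integration.integrable_sum integrable_mult_right schrodinger_kernel_integrable[OF wave t2])
    moreover have "f = (\<lambda>p. \<Sum>j<L. cis (- (2 * pi * real j * of_int m / real L)) *
        (case p of (s, y) \<Rightarrow> K s y * modulated_wave N B L j s y))"
      by (auto simp: f_def fun_eq_iff sum_distrib_left mult.left_commute)
    ultimately show ?thesis by simp
  qed
  have emE: "emeasure (lborel \<Otimes>\<^sub>M lborel) E = ennreal (1 / (2 * N)) * emeasure lborel B"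
    unfolding E_def
  proof (rule emeasure_resonant_set[OF B])
    fix y assume "y \<in> B"
    with xB have "norm x + norm y \<in> {7/2 * N..9/2 * N}" by blast
    \<comment> \<open>\<open>2 N t - |x| - |y|\<close> lies between \<open>N/4\<close> and
      \<open>7N/4\<close>. As \<open>N\<close> is at least 4, the margin \<open>N/4\<close> on
      either side absorbs the rounding in \<open>m\<close> and the extra 1.\<close>
    then show "norm y \<le> of_int m \<and> of_int m + 1 - norm y \<le> 2 * N"
      using Nt m N by (auto; linarith)
  qed (use N in simp)
  have E [measurable]: "E \<in> sets (lborel \<Otimes>\<^sub>M lborel)"
  proof -
    have "{p \<in> space (borel \<Otimes>\<^sub>M borel). fst p \<in> {0..1} \<and> snd p \<in> B \<and> \<lfloor>norm (snd p) + 2 * N * fst p\<rfloor> = m}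
        \<in> sets (borel \<Otimes>\<^sub>M borel)"
      by measurable
    then show ?thesis
      by (simp add: E_def space_pair_measure case_prod_beta')
  qed
  have finB: "emeasure lborel B < \<infinity>"
    using bdd by (rule emeasure_bounded_finite)
  then have finE: "emeasure (lborel \<Otimes>\<^sub>M lborel) E < \<infinity>"
    using emE by (simp add: ennreal_mult_less_top)
  have measE: "measure (lborel \<Otimes>\<^sub>M lborel) E = measure lborel B / (2 * N)"
    using emE N by (simp add: measure_def enn2real_mult)
  \<comment> \<open>After rotation by \<open>cis a\<close> the integrand on \<open>E\<close> has an
    argument of modulus at most 1; off \<open>E\<close> it is zero.\<close>
  have pos: "indicator E p * (real L * d) \<le> Re (f p * cis a)" for p
  proof (cases "p \<in> E")
    case True
    obtain s y where p: "p = (s, y)" by (cases p)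
    have s: "s \<in> {0..1}" and y: "y \<in> B" and k: "\<lfloor>norm y + 2 * N * s\<rfloor> = m"
      using True by (auto simp: E_def p)
    define b where "b = - ((norm (x - y))\<^sup>2 / (4 * (t - s))) + N\<^sup>2 * s + N * norm y + a"
    have "\<bar>b\<bar> \<le> 1"
      unfolding b_def a_def
      using s t xB[OF y] k by (intro phase_bound) (auto simp: m_def)
    then have "1 / 2 \<le> Re (cis b)" by (rule Re_cis_ge_half)
    have "(t - s) powr (real CARD('n) / 2) \<le> 3 powr (real CARD('n) / 2)"
      using s t by (intro powr_mono2) auto
    then have d: "d \<le> (1 / 2) / (t - s) powr (real CARD('n) / 2)"
      using s t unfolding d_def by (simp add: powr_minus field_simps)
    also have "\<dots> \<le> Re (cis b) / (t - s) powr (real CARD('n) / 2)"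
      using \<open>1 / 2 \<le> Re (cis b)\<close> by (intro divide_right_mono) auto
    finally have "real L * d \<le> real L * (Re (cis b) / (t - s) powr (real CARD('n) / 2))"
      by (rule mult_left_mono) simp
    moreover have "f p * cis a = of_nat L * (cis b / of_real ((t - s) powr (real CARD('n) / 2)))"
    proof -
      have "exp (- (\<i> * of_real ((norm (x - y))\<^sup>2 / (4 * (t - s))))) = cis (- ((norm (x - y))\<^sup>2 / (4 * (t - s))))"
        by (simp add: cis_conv_exp)
      then have "f p * cis a = of_nat L * ((cis (- ((norm (x - y))\<^sup>2 / (4 * (t - s)))) * cis (N\<^sup>2 * s + N * norm y) * cis a)
          / of_real ((t - s) powr (real CARD('n) / 2)))"
        using True unfolding p f_eq K_def by simp
      then show ?thesis
        by (simp only: cis_mult b_def add.assoc)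
    qed
    ultimately show ?thesis
      using True by (simp add: Re_divide_of_real del: cis.sel)
  next
    case False
    then show ?thesis
      using f_eq[of "fst p" "snd p"] by simp
  qed
  have "real L * d * measure (lborel \<Otimes>\<^sub>M lborel) E = (LINT p|(lborel \<Otimes>\<^sub>M lborel). indicator E p * (real L * d))"
    using finE by (simp add: space_pair_measure)
  also have "\<dots> \<le> (LINT p|(lborel \<Otimes>\<^sub>M lborel). Re (f p * cis a))"
    using finE int
    by (intro integral_mono pos integrable_mult_left integrable_real_indicator E
        integrable_bounded_linear[OF bounded_linear_Re] integrable_mult_left)
  also have "\<dots> = Re ((LINT p|(lborel \<Otimes>\<^sub>M lborel). f p) * cis a)"
    using int by (simp add: integral_bounded_linear[OF bounded_linear_Re])
  also have "\<dots> \<le> norm ((LINT p|(lborel \<Otimes>\<^sub>M lborel). f p) * cis a)"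
    by (rule complex_Re_le_cmod)
  also have "\<dots> = norm (LINT p|(lborel \<Otimes>\<^sub>M lborel). f p)"
    by (simp add: norm_mult)
  finally have "c * (real L * d * measure (lborel \<Otimes>\<^sub>M lborel) E) \<le> c * norm (LINT p|(lborel \<Otimes>\<^sub>M lborel). f p)"
    by (rule mult_left_mono) (simp add: c_def)
  also have "\<dots> = norm (\<Sum>j<L. cis (- (2 * pi * real j * of_int m / real L)) * schrodinger_solution (modulated_wave N B L j) t x)"
    unfolding S by (simp add: norm_mult c_def)
  \<comment> \<open>The weights are unimodular, so the triangle inequality removes them.\<close>
  also have "\<dots> \<le> (\<Sum>j<L. norm (schrodinger_solution (modulated_wave N B L j) t x))"
    by (rule order_trans[OF norm_sum]) (simp add: norm_mult)
  finally show ?thesis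
    unfolding measE c_def d_def by (simp add: mult_ac)
qed

section \<open>Reciprocal exponents and the estimate tested on the waves\<close>

lemma real_of_inverse_exponent_bounds:
  assumes "(1::ereal) \<le> p"
  shows "ereal (real_of_ereal (1 / p)) = 1 / p" "0 \<le> real_of_ereal (1 / p)"
  using assms by (cases p; auto simp: one_ereal_def)+

lemma conjugate_exponents_reciprocal:
  assumes "conjugate_exponents p p'"
  shows "real_of_ereal (1 / p') = 1 - real_of_ereal (1 / p)" "1 \<le> p'"
proof -
  have p: "1 \<le> p" "1 \<le> p'" "1 / p + 1 / p' = 1"
    using assms by (auto simp: conjugate_exponents_def)
  then have "ereal (real_of_ereal (1 / p) + real_of_ereal (1 / p')) = 1"
    by (simp add: real_of_inverse_exponent_bounds flip: plus_ereal.simps(1))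
  then show "real_of_ereal (1 / p') = 1 - real_of_ereal (1 / p)"
    by (simp add: one_ereal_def)
  show "1 \<le> p'" by fact
qed

text \<open>The lower bound is integrated over \<open>A\<close> and a time interval of length 1/4,
  while Hoelder and the assumed estimate bound each wave from above. The 8 is the product of this 4
  and the 2 in \<open>1 / (2 * N)\<close>; the 4 on the right is the Hoelder loss.\<close>

lemma estimate_on_resonant_sets:
  fixes A B :: "(real ^ 'n::finite) set"
  assumes exponents: "1 \<le> r" "1 \<le> q" "1 \<le> rt'" "1 \<le> qt'" and "0 < C"
    and estimate: "\<forall>F :: real \<Rightarrow> real ^ 'n \<Rightarrow> complex. forcing_term F \<longrightarrow>
      mixed_norm r q {2..3} (schrodinger_solution F) \<le> ennreal C * mixed_norm rt' qt' {0..1} F"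
    and A [measurable]: "A \<in> sets borel" "bounded A" "0 < measure lborel A"
    and B [measurable]: "B \<in> sets borel" "bounded B" "0 < measure lborel B"
    and N: "4 \<le> N"
    and AB: "\<And>x y. x \<in> A \<Longrightarrow> y \<in> B \<Longrightarrow> norm x * norm y \<le> 1 / 2 \<and> norm x + norm y \<in> {7/2 * N..9/2 * N}"
  shows "(4 * pi) powr (- real CARD('n) / 2) * (3 powr (- real CARD('n) / 2) / 2) / 8 *
      (measure lborel A * measure lborel B) / N
    \<le> 4 * C * (measure lborel A powr (1 - real_of_ereal (1 / r)) * measure lborel B powr real_of_ereal (1 / rt'))"
    (is "?c / 8 * (?\<alpha> * ?\<beta>) / N \<le> 4 * C * (?\<alpha>' * ?\<beta>')")
proof -
  obtain L :: nat where L: "9 * N + 9 \<le> real L"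
    using real_arch_simple by blast
  then have "0 < L" using N by (cases L) auto
  let ?u = "\<lambda>j. schrodinger_solution (modulated_wave N B L j)"
  have emA: "emeasure lborel A = ennreal ?\<alpha>" and emB: "emeasure lborel B = ennreal ?\<beta>"
    using emeasure_bounded_finite[OF A(2)] emeasure_bounded_finite[OF B(2)]
    by (auto simp: emeasure_eq_ennreal_measure)
  have wave: "forcing_term (modulated_wave N B L j)" for j
    using B(1,2) by (rule forcing_term_modulated_wave)
  have u [measurable]: "case_prod (?u j) \<in> borel_measurable (borel \<Otimes>\<^sub>M borel)" for j
    using schrodinger_solution_measurable[OF wave] by (simp add: borel_prod)
  have B_ne: "B \<noteq> {}" using B(3) by auto
  have "ennreal (real L * (?c * (?\<beta> / (2 * N)))) * ennreal (1 / 4) * ennreal ?\<alpha>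
      = (\<integral>\<^sup>+x\<in>A. (\<integral>\<^sup>+t\<in>{19/8..21/8::real}. ennreal (real L * (?c * (?\<beta> / (2 * N)))) \<partial>lborel) \<partial>lborel)"
    using emA by (simp add: nn_integral_cmult)
  also have "\<dots> \<le> (\<integral>\<^sup>+x\<in>A. (\<integral>\<^sup>+t\<in>{2..3}. (\<Sum>j<L. ennreal (norm (?u j t x))) \<partial>lborel) \<partial>lborel)"
  proof -
    have "ennreal (real L * (?c * (?\<beta> / (2 * N)))) \<le> (\<Sum>j<L. ennreal (norm (?u j t x)))"
      if "x \<in> A" "t \<in> {19/8..21/8}" for x t
    proof -
      obtain y where "y \<in> B" using B_ne by blast
      then have "norm x \<le> 9/2 * N"
        using AB[OF that(1), of y] norm_ge_zero[of y] by (auto; linarith)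
      then have "real L * (?c * (?\<beta> / (2 * N))) \<le> (\<Sum>j<L. norm (?u j t x))"
        using sum_norm_schrodinger_solution_ge[OF B(1,2) N that(2) AB[OF that(1)] _ L] by blast
      then show ?thesis by (subst sum_ennreal) (auto intro: ennreal_leI)
    qed
    then show ?thesis
      by (intro nn_integral_mono) (auto split: split_indicator intro!: nn_integral_mono)
  qed
  also have "\<dots> = (\<Sum>j<L. \<integral>\<^sup>+x\<in>A. (\<integral>\<^sup>+t\<in>{2..3}. ennreal (norm (?u j t x)) \<partial>lborel) \<partial>lborel)"
    by (simp add: sum_distrib_right nn_integral_sum del: sum_ennreal sum_mult_indicator)
  also have "\<dots> \<le> (\<Sum>j<L. 4 * ennreal ?\<alpha>' * (ennreal C * ennreal ?\<beta>'))"
  proof (rule sum_mono)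
    fix j
    have "(\<integral>\<^sup>+x\<in>A. (\<integral>\<^sup>+t\<in>{2..3}. ennreal (norm (?u j t x)) \<partial>lborel) \<partial>lborel)
        \<le> 4 * ennreal ?\<alpha>' * mixed_norm r q {2..3} (?u j)"
      using emA A exponents schrodinger_solution_measurable[OF wave]
      by (intro L1_le_mixed_norm) auto
    also have "\<dots> \<le> 4 * ennreal ?\<alpha>' * (ennreal C * mixed_norm rt' qt' {0..1} (modulated_wave N B L j))"
      by (intro mult_left_mono estimate[rule_format] wave) auto
    also have "mixed_norm rt' qt' {0..1} (modulated_wave N B L j) = ennreal ?\<beta>'"
      using emB B exponents by (intro mixed_norm_indicator) (auto simp: norm_modulated_wave)
    finally show "(\<integral>\<^sup>+x\<in>A. (\<integral>\<^sup>+t\<in>{2..3}. ennreal (norm (?u j t x)) \<partial>lborel) \<partial>lborel)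
        \<le> 4 * ennreal ?\<alpha>' * (ennreal C * ennreal ?\<beta>')" .
  qed
  also have "\<dots> = ennreal (real L * (4 * ?\<alpha>' * (C * ?\<beta>')))"
    using \<open>0 < C\<close> by (simp add: ennreal_mult ennreal_of_nat_eq_real_of_nat)
  finally have "ennreal (real L * (?c * (?\<beta> / (2 * N)))) * ennreal (1 / 4) * ennreal ?\<alpha>
      \<le> ennreal (real L * (4 * ?\<alpha>' * (C * ?\<beta>')))" .
  then have "ennreal (real L * (?c * (?\<beta> / (2 * N))) * (1 / 4) * ?\<alpha>) \<le> ennreal (real L * (4 * ?\<alpha>' * (C * ?\<beta>')))"
    using ennreal_mult''[of "1 / 4" "real L * (?c * (?\<beta> / (2 * N)))"]
      ennreal_mult''[of ?\<alpha> "real L * (?c * (?\<beta> / (2 * N))) * (1 / 4)"]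
    by (simp only: measure_nonneg zero_le_divide_1_iff zero_le_numeral simp_thms)
  then have "real L * (?c * (?\<beta> / (2 * N))) * (1 / 4) * ?\<alpha> \<le> real L * (4 * ?\<alpha>' * (C * ?\<beta>'))"
    using \<open>0 < C\<close> by (subst (asm) ennreal_le_iff) auto
  then have "real L * (?c / 8 * (?\<alpha> * ?\<beta>) / N) \<le> real L * (4 * C * (?\<alpha>' * ?\<beta>'))"
    by (simp add: mult_ac)
  \<comment> \<open>Both sides carry the factor \<open>L\<close>, so the number of characters, which
    grows with \<open>N\<close>, cancels.\<close>
  then show ?thesis
    using \<open>0 < L\<close> by (simp only: mult_le_cancel_left_pos of_nat_0_less_iff)
qed

section \<open>Comparison of powers of \<open>N\<close> and the conclusion\<close>

lemma powr_bounded_imp_nonpos: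
  fixes e D :: real
  assumes "\<And>N. 4 \<le> N \<Longrightarrow> N powr e \<le> D"
  shows "e \<le> 0"
proof (rule ccontr)
  assume "\<not> e \<le> 0"
  then have "filterlim (\<lambda>N. N powr e) at_top at_top"
    by real_asymp
  then have "eventually (\<lambda>N. D + 1 \<le> N powr e) at_top"
    by (simp add: filterlim_at_top)
  then have "eventually (\<lambda>N::real. False) at_top"
    using eventually_ge_at_top[of 4] by eventually_elim (use assms in force)
  then show False by simp
qed

text \<open>The volumes of the large and the small ball are of order \<open>N^n\<close> and
  \<open>N^(-n)\<close>. Division by their product leaves \<open>N^(n a - n b - 1)\<close> bounded
  as \<open>N\<close> grows. Stating this for arbitrary real \<open>a\<close> and \<open>b\<close>
  lets it serve with the two exchanged.\<close>

lemma exponent_gap_le: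
  fixes a b n V :: real
  assumes V: "0 < V" and k: "0 < k" and n: "0 < n"
    and bound: "\<And>N. 4 \<le> N \<Longrightarrow>
      k * ((V * (2/5 * N) powr n) * (V * (1 / (10 * N)) powr n)) / N
      \<le> D * ((V * (2/5 * N) powr n) powr (1 - a) * (V * (1 / (10 * N)) powr n) powr (1 - b))"
  shows "a - b \<le> 1 / n"
proof -
  define K1 where "K1 = V * (2/5) powr n"
  define K2 where "K2 = V * (1/10) powr n"
  have "N powr (n * a - n * b - 1) \<le> D / k * (K1 powr (- a) * K2 powr (- b))" if N: "4 \<le> N" for N
  proof -
    define X where "X = V * (2/5 * N) powr n"
    define Y where "Y = V * (1 / (10 * N)) powr n"
    have X: "X = K1 * N powr n"
      using N unfolding X_def K1_def by (subst powr_mult) auto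
    have "1 / (10 * N) = 1 / 10 * inverse N" by (simp add: field_simps)
    then have Y: "Y = K2 * N powr (- n)"
      using N by (simp only: Y_def K2_def powr_mult) (simp add: powr_minus inverse_powr)
    have pos: "0 < X" "0 < Y" "0 < X * Y" using V N by (auto simp: X_def Y_def)
    have "k * (X * Y) / N \<le> D * (X powr (1 - a) * Y powr (1 - b))"
      using bound[OF N] by (simp add: X_def Y_def)
    also have "\<dots> = (X * Y) * (D * (X powr (- a) * Y powr (- b)))"
      using pos by (simp add: powr_diff powr_minus field_simps)
    finally have "(X * Y) * (k / N) \<le> (X * Y) * (D * (X powr (- a) * Y powr (- b)))"
      by (simp add: mult_ac)
    then have "k / N \<le> D * (X powr (- a) * Y powr (- b))"
      using pos by (simp only: mult_le_cancel_left_pos)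
    also have "\<dots> = D * (K1 powr (- a) * K2 powr (- b)) * (N powr (n * (- a)) * N powr (- n * (- b)))"
      using N by (simp only: X Y powr_mult powr_powr mult_ac)
    also have "\<dots> = D * (K1 powr (- a) * K2 powr (- b)) * N powr (n * b - n * a)"
      by (simp flip: powr_add)
    finally have "k * N powr (- 1) \<le> D * (K1 powr (- a) * K2 powr (- b)) * N powr (n * b - n * a)"
      using N by (simp add: powr_minus divide_inverse)
    then have "k * N powr (- 1) * N powr (n * a - n * b)
        \<le> D * (K1 powr (- a) * K2 powr (- b)) * N powr (n * b - n * a) * N powr (n * a - n * b)"
      by (rule mult_right_mono) simp
    moreover have "N powr (- 1) * N powr (n * a - n * b) = N powr (n * a - n * b - 1)"
      "N powr (n * b - n * a) * N powr (n * a - n * b) = 1"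
      using N by (simp_all add: powr_diff)
    ultimately have "k * N powr (n * a - n * b - 1) \<le> D * (K1 powr (- a) * K2 powr (- b))"
      by (simp only: mult.assoc mult_1_right)
    then show ?thesis
      using k by (simp add: field_simps)
  qed
  then have "n * a - n * b - 1 \<le> 0"
    by (rule powr_bounded_imp_nonpos)
  then show ?thesis
    using n by (simp add: field_simps)
qed

lemma measure_lborel_ball:
  fixes c :: "real ^ 'n::finite"
  assumes "0 < R"
  shows "measure lborel (ball c R) = unit_ball_vol (real CARD('n)) * R powr real CARD('n)"
  using content_ball[of R c] assms by (simp add: powr_realpow)

theorem mainTheorem4:
  fixes r q rt qt rt' qt' :: ereal and C :: real
  assumes dim: "CARD('n::finite) \<ge> 3"
    and exponents: "1 \<le> r" "1 \<le> q" "1 \<le> rt" "1 \<le> qt"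
    and conj_r: "conjugate_exponents rt rt'"
    and conj_q: "conjugate_exponents qt qt'"
    and C_pos: "C > 0"
    and estimate: "\<And>F :: real \<Rightarrow> real ^ 'n \<Rightarrow> complex. forcing_term F \<Longrightarrow>
      mixed_norm r q {2..3} (schrodinger_solution F) \<le> ennreal C * mixed_norm rt' qt' {0..1} F"
  shows "1 / r - 1 / rt \<le> 1 / ereal (real CARD('n)) \<and>
         1 / rt - 1 / r \<le> 1 / ereal (real CARD('n))"
proof -
  define n where "n = real CARD('n)"
  define V where "V = unit_ball_vol n"
  define a where "a = real_of_ereal (1 / r)"
  define b where "b = real_of_ereal (1 / rt)"
  define k where "k = (4 * pi) powr (- n / 2) * (3 powr (- n / 2) / 2) / 8"
  have n: "0 < n" by (simp add: n_def)
  have V: "0 < V" by (simp add: V_def n_def)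
  have k: "0 < k" by (simp add: k_def)
  have rt': "real_of_ereal (1 / rt') = 1 - b" "1 \<le> rt'" and qt': "1 \<le> qt'"
    using conjugate_exponents_reciprocal[OF conj_r] conjugate_exponents_reciprocal[OF conj_q]
    by (auto simp: b_def)
  obtain e :: "real ^ 'n" where e: "norm e = 1"
    using norm_axis_1 by blast
  \<comment> \<open>With these radii \<open>|x|\<close> lies between \<open>18/5 N\<close> and
    \<open>22/5 N\<close> on \<open>big N\<close>, and \<open>|y|\<close> is at most
    \<open>1 / (10 N)\<close> on \<open>small N\<close>. So \<open>|x| |y|\<close> is at most 11/25,
    and adding \<open>|y|\<close>, which is below \<open>N/10\<close>, keeps the sum below
    \<open>9/2 N\<close>.\<close>
  define big where "big N = ball ((4 * N) *\<^sub>R e) (2/5 * N)" for N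
  define small where "small N = ball (0 :: real ^ 'n) (1 / (10 * N))" for N
  have close: "norm x * norm y \<le> 1 / 2 \<and> norm x + norm y \<in> {7/2 * N..9/2 * N}"
    if N: "4 \<le> N" and x: "x \<in> big N" and y: "y \<in> small N" for N x y
  proof -
    have ne: "norm ((4 * N) *\<^sub>R e) = 4 * N" using e N by simp
    have "norm ((4 * N) *\<^sub>R e - x) < 2/5 * N"
      using x by (simp add: big_def dist_norm)
    then have nx: "18/5 * N \<le> norm x" "norm x \<le> 22/5 * N"
      using ne norm_triangle_ineq2[of "(4 * N) *\<^sub>R e" x] norm_triangle_ineq2[of x "(4 * N) *\<^sub>R e"]
      by (auto simp: norm_minus_commute)
    have ny: "norm y \<le> 1 / (10 * N)"
      using y by (simp add: small_def)
    also have "\<dots> \<le> 1 / 40"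
      using N by (simp add: field_simps)
    finally have "norm y \<le> 1/10 * N" using N by linarith
    moreover have "norm x * norm y \<le> 22/5 * N * (1 / (10 * N))"
      using nx ny N by (intro mult_mono) auto
    moreover have "22/5 * N * (1 / (10 * N)) \<le> 1 / 2"
      using N by simp
    moreover have "7/2 * N \<le> 18/5 * N" using N by simp
    ultimately show ?thesis using nx norm_ge_zero[of y] by (auto; linarith)
  qed
  have meas: "measure lborel (big N) = V * (2/5 * N) powr n"
      "measure lborel (small N) = V * (1 / (10 * N)) powr n" if "4 \<le> N" for N
    unfolding big_def small_def V_def n_def using that by (intro measure_lborel_ball; simp)+
  have meas_pos: "0 < measure lborel (big N)" "0 < measure lborel (small N)" if "4 \<le> N" for N
    using that V meas[OF that] by auto
  have sets: "big N \<in> sets borel" "bounded (big N)" "small N \<in> sets borel" "bounded (small N)" for N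
    by (auto simp: big_def small_def)
  have "\<forall>F :: real \<Rightarrow> real ^ 'n \<Rightarrow> complex. forcing_term F \<longrightarrow>
      mixed_norm r q {2..3} (schrodinger_solution F) \<le> ennreal C * mixed_norm rt' qt' {0..1} F"
    using estimate by blast
  note resonant = estimate_on_resonant_sets[OF exponents(1,2) rt'(2) qt' C_pos this,
      folded n_def, folded k_def a_def, unfolded rt'(1)]
  \<comment> \<open>The forcing terms live on the small ball and the solution is observed on the
    large one.\<close>
  have "a - b \<le> 1 / n"
  proof (rule exponent_gap_le[OF V k n, of "4 * C"])
    fix N :: real assume N: "4 \<le> N"
    show "k * ((V * (2/5 * N) powr n) * (V * (1 / (10 * N)) powr n)) / N
      \<le> 4 * C * ((V * (2/5 * N) powr n) powr (1 - a) * (V * (1 / (10 * N)) powr n) powr (1 - b))"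
      using resonant[OF sets(1,2) meas_pos(1)[OF N] sets(3,4) meas_pos(2)[OF N] N close[OF N]] N by (simp add: meas)
  qed
  \<comment> \<open>Instead of duality, the balls exchange roles: the forcing terms live on the
    large ball, and \<open>exponent_gap_le\<close> is applied with \<open>a\<close> and
    \<open>b\<close> exchanged.\<close>
  moreover have "b - a \<le> 1 / n"
  proof (rule exponent_gap_le[OF V k n, of "4 * C"])
    fix N :: real assume N: "4 \<le> N"
    have "k * (measure lborel (small N) * measure lborel (big N)) / N
      \<le> 4 * C * (measure lborel (small N) powr (1 - a) * measure lborel (big N) powr (1 - b))"
    proof (rule resonant[OF sets(3,4) meas_pos(2)[OF N] sets(1,2) meas_pos(1)[OF N] N])
      fix x y assume "x \<in> small N" "y \<in> big N"
      then show "norm x * norm y \<le> 1 / 2 \<and> norm x + norm y \<in> {7/2 * N..9/2 * N}"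
        using close[OF N, of y x] by (simp add: mult.commute add.commute)
    qed
    then show "k * ((V * (2/5 * N) powr n) * (V * (1 / (10 * N)) powr n)) / N
      \<le> 4 * C * ((V * (2/5 * N) powr n) powr (1 - b) * (V * (1 / (10 * N)) powr n) powr (1 - a))"
      using N by (simp add: meas mult_ac)
  qed
  moreover have "1 / r = ereal a" "1 / rt = ereal b" "1 / ereal n = ereal (1 / n)"
    using real_of_inverse_exponent_bounds exponents n by (auto simp: a_def b_def one_ereal_def)
  ultimately show ?thesis
    unfolding n_def[symmetric] by simp
qed

end
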